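(* Let $F$ be a finite ordered set and let $\min(F)$ be its set of minimal elements. Then $F$ is a confluence if and only if for every $m\in\min(F)$ the set $F^m$ is a lattice.
   Context: For an ordered set $E$ and $t\in E$, $E^t=\{x\in E : x\ge t\}$. A (finite) ordered set $F$ is a confluence if for every $t\in F$ the set $F^t$ (with the induced order) is a meet-semilattice with a greatest element. *)

theory Defs
  imports "HOL-Algebra.Lattice"
begin

definition up_gorder :: "('a, 'b) gorder_scheme \<Rightarrow> 'a \<Rightarrow> ('a, 'b) gorder_scheme"
  where "up_gorder E t = E\<lparr>carrier := {x \<in> carrier E. t \<sqsubseteq>\<^bsub>E\<^esub> x}\<rparr>"

definition minimals :: "('a, 'b) gorder_scheme \<Rightarrow> 'a set"
  where "minimals E = {m \<in> carrier E. \<forall>x \<in> carrier E. x \<sqsubseteq>\<^bsub>E\<^esub> m \<longrightarrow> x = m}"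

definition confluence :: "('a, 'b) gorder_scheme \<Rightarrow> bool"
  where "confluence F \<longleftrightarrow>
    partial_order F \<and> finite (carrier F) \<and>
    (\<forall>t \<in> carrier F. lower_semilattice (up_gorder F t) \<and>
       (\<exists>g. greatest (up_gorder F t) g (carrier (up_gorder F t))))"

end

theory Submission
  imports Defs
begin

text \<open>In a finite meet-semilattice with a greatest element, the join of two elements is the meet of
  their nonempty set of upper bounds. Conversely, every \<open>t\<close> lies above a minimal \<open>m\<close>; \<open>F\<^sup>t\<close> is an
  up-set of the finite lattice \<open>F\<^sup>m\<close>, is closed under its meets because \<open>t\<close> is a lower bound, and
  contains its greatest element.\<close>

lemma carrier_up_gorder [simp]:
  "carrier (up_gorder E t) = {x \<in> carrier E. t \<sqsubseteq>\<^bsub>E\<^esub> x}"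
  by (simp add: up_gorder_def)

lemma le_up_gorder [simp]: "le (up_gorder E t) = le E"
  by (simp add: up_gorder_def)

lemma eq_up_gorder [simp]: "eq (up_gorder E t) = eq E"
  by (simp add: up_gorder_def)

text \<open>By transitivity everything above \<open>t\<close> is already above \<open>m\<close>.
  This lets results about up-sets inside the lattice \<open>up_gorder F m\<close> be read as results
  about \<open>up_gorder F t\<close>.\<close>

lemma (in partial_order) up_gorder_up_gorder:
  assumes "m \<in> carrier L" "t \<in> carrier L" "m \<sqsubseteq> t"
  shows "up_gorder (up_gorder L m) t = up_gorder L t"
proof -
  have "{x \<in> carrier (up_gorder L m). t \<sqsubseteq> x} = {x \<in> carrier L. t \<sqsubseteq> x}"
    using assms le_trans by auto
  then show ?thesis
    by (simp add: up_gorder_def)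
qed

lemma (in partial_order) partial_order_up_gorder: "partial_order (up_gorder L t)"
proof -
  \<comment> \<open>Restriction is done for weak orders; that the equivalence is equality carries
    over since \<open>up_gorder\<close> changes only the carrier.\<close>
  interpret up: weak_partial_order "up_gorder L t"
    unfolding up_gorder_def
    by (rule weak_partial_order_subset) (auto intro: weak_partial_order_axioms)
  show ?thesis
    by unfold_locales (simp add: eq_is_equal)
qed

text \<open>A minimal element of the finite set of elements below \<open>t\<close> is minimal in all
  of \<open>L\<close>, since anything below it is again below \<open>t\<close>.\<close>

lemma (in partial_order) exists_minimal_below:
  assumes "finite (carrier L)" "t \<in> carrier L"
  shows "\<exists>m \<in> minimals L. m \<sqsubseteq> t"
proof -
  let ?D = "{x \<in> carrier L. x \<sqsubseteq> t}"
  let ?R = "\<lambda>x y. x \<sqsubseteq> y \<and> x \<noteq> y"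
  have "asymp_on ?D ?R"
    by (auto intro!: asymp_onI le_antisym)
  moreover have "transp_on ?D ?R"
  proof (rule transp_onI)
    fix x y z
    assume "x \<in> ?D" "y \<in> ?D" "z \<in> ?D" "?R x y" "?R y z"
    then show "?R x z"
      using le_trans[of x y z] le_antisym[of x y] by auto
  qed
  moreover have "finite ?D" "?D \<noteq> {}"
    using assms by auto
  ultimately obtain m where m: "m \<in> ?D" "\<forall>x \<in> ?D. x \<noteq> m \<longrightarrow> \<not> ?R x m"
    using Finite_Set.bex_min_element[of ?D ?R] by blast
  have "x = m" if "x \<in> carrier L" "x \<sqsubseteq> m" for x
    using that m assms(2) le_trans[of x m t] by auto
  with m(1) show ?thesis
    by (auto simp: minimals_def)
qed

lemma (in lower_semilattice) lower_semilattice_up_gorder: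
  assumes t: "t \<in> carrier L"
  shows "lower_semilattice (up_gorder L t)"
proof -
  interpret up: partial_order "up_gorder L t"
    by (rule partial_order_up_gorder)
  show ?thesis
  proof
    fix x y
    assume "x \<in> carrier (up_gorder L t)" "y \<in> carrier (up_gorder L t)"
    then have xy: "x \<in> carrier L" "y \<in> carrier L" "t \<sqsubseteq> x" "t \<sqsubseteq> y"
      by auto
    then obtain i where i: "greatest L i (Lower L {x, y})"
      using inf_of_two_exists by blast
    \<comment> \<open>\<open>t\<close> is itself a lower bound of \<open>x\<close> and
      \<open>y\<close>, so their meet in \<open>L\<close> stays in the up-set and is the meet there
      too.\<close>
    have "t \<sqsubseteq> i"
      using xy t by (intro greatest_le[OF i]) (auto simp: Lower_def)
    with i xy have "greatest (up_gorder L t) i (Lower (up_gorder L t) {x, y})"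
      by (auto simp: greatest_def Lower_def)
    then show "\<exists>s. greatest (up_gorder L t) s (Lower (up_gorder L t) {x, y})" ..
  qed
qed

lemma (in upper_semilattice) finite_greatest_up_gorder:
  assumes "finite (carrier L)" "t \<in> carrier L"
  shows "\<exists>g. greatest (up_gorder L t) g (carrier (up_gorder L t))"
proof -
  \<comment> \<open>The carrier contains \<open>t\<close>, so this is the join of a finite nonempty
    set: the top of \<open>L\<close>, which lies above \<open>t\<close>.\<close>
  have "least L (\<Squnion>(carrier L)) (Upper L (carrier L))"
    using assms by (intro finite_sup_least) auto
  then have "greatest (up_gorder L t) (\<Squnion>(carrier L)) (carrier (up_gorder L t))"
    using assms(2) by (auto simp: least_def greatest_def Upper_def)
  then show ?thesis ..
qed

lemma (in lower_semilattice) finite_greatest_imp_lattice: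
  assumes fin: "finite (carrier L)" and top: "greatest L g (carrier L)"
  shows "lattice L"
proof
  fix x y
  assume xy: "x \<in> carrier L" "y \<in> carrier L"
  have "Upper L {x, y} \<subseteq> carrier L"
    by simp
  \<comment> \<open>This is where \<open>g\<close> matters: finite meets exist only for nonempty
    sets.\<close>
  moreover have "g \<in> Upper L {x, y}"
    using top xy by (auto simp: greatest_def Upper_def)
  ultimately have inf: "greatest L (\<Sqinter>(Upper L {x, y})) (Lower L (Upper L {x, y}))"
    using fin by (intro finite_inf_greatest) (auto intro: finite_subset)
  have "least L (\<Sqinter>(Upper L {x, y})) (Upper L {x, y})"
  proof (rule least_UpperI)
    fix z
    assume "z \<in> {x, y}"
    \<comment> \<open>Both \<open>x\<close> and \<open>y\<close> are lower bounds of their upper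
      bounds, hence below the greatest such lower bound.\<close>
    then show "z \<sqsubseteq> \<Sqinter>(Upper L {x, y})"
      using xy by (intro greatest_le[OF inf]) (auto simp: Lower_def Upper_def)
  next
    fix u
    assume "u \<in> Upper L {x, y}"
    then show "\<Sqinter>(Upper L {x, y}) \<sqsubseteq> u"
      by (rule greatest_Lower_below[OF inf]) simp
  qed (use xy inf in auto)
  then show "\<exists>s. least L s (Upper L {x, y})" ..
qed

theorem lemma2:
  fixes F :: "('a, 'b) gorder_scheme"
  assumes "partial_order F" and "finite (carrier F)"
  shows "confluence F \<longleftrightarrow> (\<forall>m \<in> minimals F. lattice (up_gorder F m))"
proof
  assume conf: "confluence F"
  show "\<forall>m \<in> minimals F. lattice (up_gorder F m)"
  proof
    fix m
    assume "m \<in> minimals F"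
    then have "m \<in> carrier F"
      by (simp add: minimals_def)
    with conf obtain g where "lower_semilattice (up_gorder F m)"
      and "greatest (up_gorder F m) g (carrier (up_gorder F m))"
      unfolding confluence_def by blast
    moreover have "finite (carrier (up_gorder F m))"
      using assms(2) by simp
    ultimately show "lattice (up_gorder F m)"
      by (intro lower_semilattice.finite_greatest_imp_lattice)
  qed
next
  assume lat: "\<forall>m \<in> minimals F. lattice (up_gorder F m)"
  interpret F: partial_order F
    by fact
  have "lower_semilattice (up_gorder F t) \<and>
      (\<exists>g. greatest (up_gorder F t) g (carrier (up_gorder F t)))"
    if t: "t \<in> carrier F" for t
  proof -
    obtain m where m: "m \<in> minimals F" "m \<sqsubseteq>\<^bsub>F\<^esub> t"
      using F.exists_minimal_below assms(2) t by blast
    then have "m \<in> carrier F"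
      by (simp add: minimals_def)
    then have up: "up_gorder (up_gorder F m) t = up_gorder F t"
      using t m(2) by (rule F.up_gorder_up_gorder)
    interpret Fm: lattice "up_gorder F m"
      using lat m(1) by blast
    have "t \<in> carrier (up_gorder F m)" "finite (carrier (up_gorder F m))"
      using t m(2) assms(2) by auto
    \<comment> \<open>Both facts concern the up-set of \<open>t\<close> taken within
      \<open>up_gorder F m\<close>; \<open>up\<close> identifies it with the one taken in
      \<open>F\<close>.\<close>
    then show ?thesis
      using Fm.lower_semilattice_up_gorder[of t] Fm.finite_greatest_up_gorder[of t]
      unfolding up by blast
  qed
  with assms show "confluence F"
    unfolding confluence_def by blast
qed

end
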